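(* Let $G=(I,\mu,E)$ be a connected graphing. Then $\lambda_G\ge \dfrac{h_G^2}{8}$.
   Context: Let $I=[0,1]$. A bounded degree Borel graph on $I$ is a symmetric Borel set $E\subseteq I^2$ such that for some integer $D$, $|\{y:(x,y)\in E\}|\le D$ for all $x\in I$. For Borel $A\subseteq I$ let $\deg_A(x)=|\{y\in A:(x,y)\in E\}|$ and $\deg=\deg_I$. A graphing is a triple $G=(I,\mu,E)$ where $E$ is a bounded degree Borel graph and $\mu$ is a Borel probability measure on $I$ with $\int_A\deg_B\,d\mu=\int_B\deg_A\,d\mu$ for all Borel $A,B\subseteq I$. Its edge measure $\eta$ is the Borel measure on $I^2$ determined by $\eta(A\times B)=\int_A\deg_B\,d\mu$. Put $e_G(A,B)=\eta(A\times B)$ and $\mathrm{vol}_G(A)=\int_A\deg\,d\mu$. $G$ is connected if $e_G(A,A^c)\ne0$ for every Borel $A$ with $0<\mu(A)<1$. The Cheeger constant is $h_G=\inf_{A:\,0<\mu(A)<1}\frac{e_G(A,A^c)}{\min\{\mathrm{vol}_G(A),\mathrm{vol}_G(A^c)\}}$. For measurable $f:I\to\mathbb R$ set $\|f\|_v^2=\int_I f^2\deg\,d\mu$ and $\|df\|_e^2=\frac12\int_{I^2}(f(y)-f(x))^2\,d\eta(x,y)$. The bottom of the spectrum of the Laplacian is $\lambda_G=\inf\{\|df\|_e^2/\|f\|_v^2:\ 0<\|f\|_v<\infty,\ \int_I f\deg\,d\mu=0\}$. *)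

theory Defs
  imports "HOL-Probability.Probability"
begin

definition I01 :: "real set" where "I01 = {0..1}"

definition BI :: "real measure" where "BI = restrict_space borel I01"

definition deg :: "(real \<times> real) set \<Rightarrow> real set \<Rightarrow> real \<Rightarrow> nat" where
  "deg E A x = card {y \<in> A. (x, y) \<in> E}"

definition bounded_degree_borel_graph :: "(real \<times> real) set \<Rightarrow> bool" where
  "bounded_degree_borel_graph E \<longleftrightarrow>
     E \<in> sets (BI \<Otimes>\<^sub>M BI) \<and>
     (\<forall>x y. (x, y) \<in> E \<longrightarrow> (y, x) \<in> E) \<and>
     (\<exists>D::nat. \<forall>x\<in>I01. finite {y. (x, y) \<in> E} \<and> card {y. (x, y) \<in> E} \<le> D)"

definition graphing :: "real measure \<Rightarrow> (real \<times> real) set \<Rightarrow> (real \<times> real) measure \<Rightarrow> bool" where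
  "graphing \<mu> E \<eta> \<longleftrightarrow>
     bounded_degree_borel_graph E \<and>
     prob_space \<mu> \<and> sets \<mu> = sets BI \<and>
     (\<forall>A\<in>sets BI. \<forall>B\<in>sets BI.
        (\<integral>\<^sup>+ x\<in>A. of_nat (deg E B x) \<partial>\<mu>) = (\<integral>\<^sup>+ x\<in>B. of_nat (deg E A x) \<partial>\<mu>)) \<and>
     sets \<eta> = sets (BI \<Otimes>\<^sub>M BI) \<and>
     (\<forall>A\<in>sets BI. \<forall>B\<in>sets BI.
        emeasure \<eta> (A \<times> B) = (\<integral>\<^sup>+ x\<in>A. of_nat (deg E B x) \<partial>\<mu>))"

definition e_G :: "(real \<times> real) measure \<Rightarrow> real set \<Rightarrow> real set \<Rightarrow> real" where
  "e_G \<eta> A B = measure \<eta> (A \<times> B)"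

definition vol_G :: "real measure \<Rightarrow> (real \<times> real) set \<Rightarrow> real set \<Rightarrow> real" where
  "vol_G \<mu> E A = enn2real (\<integral>\<^sup>+ x\<in>A. of_nat (deg E I01 x) \<partial>\<mu>)"

definition connected_graphing :: "real measure \<Rightarrow> (real \<times> real) set \<Rightarrow> (real \<times> real) measure \<Rightarrow> bool" where
  "connected_graphing \<mu> E \<eta> \<longleftrightarrow>
     (\<forall>A\<in>sets BI. 0 < measure \<mu> A \<and> measure \<mu> A < 1 \<longrightarrow> e_G \<eta> A (I01 - A) \<noteq> 0)"

text \<open>Cheeger constant (infimum taken in the extended reals, so inf of empty set is +infinity).\<close>
definition cheeger :: "real measure \<Rightarrow> (real \<times> real) set \<Rightarrow> (real \<times> real) measure \<Rightarrow> ereal" where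
  "cheeger \<mu> E \<eta> = Inf {ereal (e_G \<eta> A (I01 - A) / min (vol_G \<mu> E A) (vol_G \<mu> E (I01 - A))) | A.
       A \<in> sets BI \<and> 0 < measure \<mu> A \<and> measure \<mu> A < 1}"

definition vnorm2 :: "real measure \<Rightarrow> (real \<times> real) set \<Rightarrow> (real \<Rightarrow> real) \<Rightarrow> ennreal" where
  "vnorm2 \<mu> E f = (\<integral>\<^sup>+ x. ennreal ((f x)\<^sup>2 * real (deg E I01 x)) \<partial>\<mu>)"

definition dnorm2 :: "(real \<times> real) measure \<Rightarrow> (real \<Rightarrow> real) \<Rightarrow> ennreal" where
  "dnorm2 \<eta> f = (\<integral>\<^sup>+ p. ennreal ((f (snd p) - f (fst p))\<^sup>2) \<partial>\<eta>) / 2"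

text \<open>Bottom of the spectrum of the Laplacian.\<close>
definition lambda_G :: "real measure \<Rightarrow> (real \<times> real) set \<Rightarrow> (real \<times> real) measure \<Rightarrow> ereal" where
  "lambda_G \<mu> E \<eta> = Inf {enn2ereal (dnorm2 \<eta> f) / enn2ereal (vnorm2 \<mu> E f) | f.
       f \<in> borel_measurable \<mu> \<and> 0 < vnorm2 \<mu> E f \<and> vnorm2 \<mu> E f < \<infinity> \<and>
       (\<integral>x. f x * real (deg E I01 x) \<partial>\<mu>) = 0}"

end

(* A Cheeger inequality in the style of Alon and Milman: subtract a volume median m from f and
   put g = f - m, G = g * |g|.  The level sets of G above (below) 0 have at most half of the
   volume, so integrating the isoperimetric inequality over all levels gives
   2 h ||g||^2 <= int |G(y) - G(x)| d eta, and AM-GM bounds the right-hand side by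
   (1/h) int (g(y) - g(x))^2 d eta + h ||g||^2.  This yields even lambda >= h^2 / 2.

   That deg is a Borel function is a genuine theorem (Lusin-Novikov for sections of bounded
   size), and without it the integrals defining lambda would be junk.  It follows from the
   Lusin-Souslin theorem: an injective continuous image of a Borel set in a Polish space is Borel. *)

theory Submission
  imports Defs
begin

section \<open>The Lusin--Souslin theorem\<close>

text \<open>Projections of Borel sets are in general only analytic, so counting the points of the
  sections of \<open>E\<close> calls for projections that are injective; bounded degree makes these
  available. Once the degree is Borel, the volume is the measure \<open>\<nu>\<close> with density
  \<open>deg\<close> over \<mu>, and both marginals of the edge measure equal \<open>\<nu>\<close>.
  From there on the graph is gone, and only a measure on pairs with equal marginals remains. The
  square of \<open>g\<close> keeps its sign in \<open>G\<close> so that one integral over all real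
  levels covers both sides of the median. Passing from \<open>f\<close> to \<open>f - m\<close>
  costs nothing: differences do not change, and since \<open>f\<close> has mean zero the shift can
  only increase the norm. The factor 2 appears because a level is crossed upwards and downwards, and
  equal marginals give both crossings the same measure. The weight in AM-GM is chosen so that
  exactly half of 2 h ||g||^2 is absorbed.\<close>

text \<open>\<open>coded \<phi> S\<close>: \<open>\<phi>\<close> is a bijection of \<open>S\<close> onto a closed subset of the Baire space
  \<open>nat \<Rightarrow> nat\<close> with continuous inverse. In this form, closure under countable intersections and
  disjoint unions needs no topology on the Baire space.\<close>

definition coded :: "('a::topological_space \<Rightarrow> nat \<Rightarrow> nat) \<Rightarrow> 'a set \<Rightarrow> bool" where
  "coded \<phi> S \<longleftrightarrow> (\<forall>z. (\<forall>n. z n \<in> S) \<and> (\<forall>i. \<exists>c. \<forall>\<^sub>F n in sequentially. \<phi> (z n) i = c) \<longrightarrow>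
     (\<exists>l\<in>S. z \<longlonglongrightarrow> l \<and> (\<forall>i. \<forall>\<^sub>F n in sequentially. \<phi> (z n) i = \<phi> l i)))"

lemma codedD:
  assumes "coded \<phi> S" "\<And>n. z n \<in> S" "\<And>i. \<exists>c. \<forall>\<^sub>F n in sequentially. \<phi> (z n) i = c"
  obtains l where "l \<in> S" "z \<longlonglongrightarrow> l" "\<And>i. \<forall>\<^sub>F n in sequentially. \<phi> (z n) i = \<phi> l i"
  using assms unfolding coded_def by blast

text \<open>The sequence alternating between \<open>x\<close> and \<open>y\<close> has a constant
  code, so it converges, and its even and odd subsequences identify the limit with both
  points.\<close>

lemma coded_inj:
  fixes S :: "'a::t2_space set"
  assumes "coded \<phi> S" "x \<in> S" "y \<in> S" "\<And>i. \<phi> x i = \<phi> y i"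
  shows "x = y"
proof -
  define z where "z n = (if even n then x else y)" for n :: nat
  have "z n \<in> S" for n using assms by (simp add: z_def)
  moreover have "\<forall>\<^sub>F n in sequentially. \<phi> (z n) i = \<phi> y i" for i
    using assms(4) by (simp add: z_def)
  ultimately obtain l where l: "z \<longlonglongrightarrow> l" using codedD[OF assms(1), of z] by metis
  have "(\<lambda>n. z (2*n)) \<longlonglongrightarrow> l" "(\<lambda>n. z (2*n+1)) \<longlonglongrightarrow> l"
    using LIMSEQ_subseq_LIMSEQ[OF l, of "\<lambda>n. 2*n"] LIMSEQ_subseq_LIMSEQ[OF l, of "\<lambda>n. 2*n+1"]
    by (simp_all add: strict_mono_def o_def)
  then have "l = x" "l = y" by (simp_all add: z_def LIMSEQ_const_iff)
  then show ?thesis by simp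
qed

text \<open>A condition on one coordinate is clopen in the Baire space: the limit inherits the
  eventual value of that coordinate. This yields codes for basic open sets, for their complements
  and for cells.\<close>

lemma coded_Collect:
  assumes "coded \<phi> S" shows "coded \<phi> {z \<in> S. P (\<phi> z i)}"
  unfolding coded_def
proof (intro allI impI, elim conjE)
  fix z :: "nat \<Rightarrow> 'a" assume z: "\<forall>n. z n \<in> {z \<in> S. P (\<phi> z i)}"
    "\<forall>i. \<exists>c. \<forall>\<^sub>F n in sequentially. \<phi> (z n) i = c"
  obtain l where l: "l \<in> S" "z \<longlonglongrightarrow> l" "\<And>i. \<forall>\<^sub>F n in sequentially. \<phi> (z n) i = \<phi> l i"
    using z by (auto intro: codedD[OF assms, of z])
  obtain n where "\<phi> (z n) i = \<phi> l i"
    using l(3)[of i] eventually_happens'[OF sequentially_bot] by blast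
  then have "P (\<phi> l i)" using z(1) by (metis (no_types, lifting) mem_Collect_eq)
  then show "\<exists>l\<in>{z \<in> S. P (\<phi> z i)}. z \<longlonglongrightarrow> l \<and> (\<forall>i. \<forall>\<^sub>F n in sequentially. \<phi> (z n) i = \<phi> l i)"
    using l by blast
qed

lemma coded_cell:
  assumes "coded \<phi> S" shows "coded \<phi> {z \<in> S. \<forall>i<n. \<phi> z i = s i}"
proof (induction n)
  case (Suc n)
  have "{z \<in> S. \<forall>i<Suc n. \<phi> z i = s i} = {z \<in> {z \<in> S. \<forall>i<n. \<phi> z i = s i}. \<phi> z n = s n}"
    by (auto simp: less_Suc_eq)
  then show ?case using coded_Collect[OF Suc.IH, of "\<lambda>c. c = s n" n] by simp
qed (use assms in simp)

text \<open>The codes are interleaved by the pairing function. Each of them produces a limit of the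
  same sequence, and uniqueness of limits puts this one point into every \<open>S k\<close>.\<close>

lemma coded_Int:
  fixes S :: "nat \<Rightarrow> 'a::t2_space set"
  assumes "\<And>k. coded (\<phi> k) (S k)"
  shows "coded (\<lambda>z m. \<phi> (fst (prod_decode m)) z (snd (prod_decode m))) (\<Inter>k. S k)"
  unfolding coded_def
proof (intro allI impI, elim conjE)
  fix z :: "nat \<Rightarrow> 'a"
  assume z: "\<forall>n. z n \<in> (\<Inter>k. S k)" and
    c: "\<forall>i. \<exists>c. \<forall>\<^sub>F n in sequentially. \<phi> (fst (prod_decode i)) (z n) (snd (prod_decode i)) = c"
  have "\<exists>l\<in>S k. z \<longlonglongrightarrow> l \<and> (\<forall>i. \<forall>\<^sub>F n in sequentially. \<phi> k (z n) i = \<phi> k l i)" for k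
  proof -
    have "\<exists>c. \<forall>\<^sub>F n in sequentially. \<phi> k (z n) i = c" for i
      using c[rule_format, of "prod_encode (k,i)"] by simp
    moreover have "\<forall>n. z n \<in> S k" using z by blast
    ultimately show ?thesis using assms[of k] unfolding coded_def by blast
  qed
  then obtain l where l: "\<And>k. l k \<in> S k" "\<And>k. z \<longlonglongrightarrow> l k"
    "\<And>k i. \<forall>\<^sub>F n in sequentially. \<phi> k (z n) i = \<phi> k (l k) i" by metis
  have eq: "l k = l 0" for k using l(2) LIMSEQ_unique by blast
  show "\<exists>l\<in>(\<Inter>k. S k). z \<longlonglongrightarrow> l \<and>
     (\<forall>i. \<forall>\<^sub>F n in sequentially. \<phi> (fst (prod_decode i)) (z n) (snd (prod_decode i)) =
        \<phi> (fst (prod_decode i)) l (snd (prod_decode i)))"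
  proof (intro bexI[of _ "l 0"] conjI allI)
    show "l 0 \<in> (\<Inter>k. S k)" using l(1) eq by (metis INT_I)
    show "z \<longlonglongrightarrow> l 0" by (rule l(2))
    show "\<forall>\<^sub>F n in sequentially. \<phi> (fst (prod_decode i)) (z n) (snd (prod_decode i)) =
        \<phi> (fst (prod_decode i)) (l 0) (snd (prod_decode i))" for i
      using l(3)[of "fst (prod_decode i)" "snd (prod_decode i)"] unfolding eq[of "fst (prod_decode i)"] .
  qed
qed

text \<open>The index of the piece is put in front of the code. Once coordinate 0 is eventually
  constant, the tail of the sequence stays in one piece; disjointness makes the index
  \<open>N\<close> unambiguous.\<close>

lemma coded_disjoint_Un:
  fixes S :: "nat \<Rightarrow> 'a::topological_space set"
  assumes S: "\<And>k. coded (\<phi> k) (S k)" and disj: "disjoint_family S"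
  defines "N \<equiv> \<lambda>z. LEAST k. z \<in> S k"
  shows "coded (\<lambda>z. case_nat (N z) (\<phi> (N z) z)) (\<Union>k. S k)"
proof -
  have N: "N z = k" if "z \<in> S k" for z k
    unfolding N_def
  proof (rule Least_equality[of "\<lambda>k. z \<in> S k", OF that])
    show "k \<le> y" if "z \<in> S y" for y
      using disjoint_family_onD[OF disj, of k y] that \<open>z \<in> S k\<close> by auto
  qed
  show ?thesis
    unfolding coded_def
  proof (intro allI impI, elim conjE)
    fix z :: "nat \<Rightarrow> 'a"
    assume z: "\<forall>n. z n \<in> (\<Union>k. S k)" and
      c: "\<forall>i. \<exists>c. \<forall>\<^sub>F n in sequentially. case_nat (N (z n)) (\<phi> (N (z n)) (z n)) i = c"
    obtain k where k: "\<forall>\<^sub>F n in sequentially. N (z n) = k" using c[rule_format, of 0] by auto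
    have zk: "\<forall>\<^sub>F n in sequentially. z n \<in> S k"
      using k by eventually_elim (use z N in blast)
    then obtain m where m: "\<And>n. n \<ge> m \<Longrightarrow> z n \<in> S k" by (auto simp: eventually_sequentially)
    \<comment> \<open>Only a tail of \<open>z\<close> lies in \<open>S k\<close>, while
      \<open>codedD\<close> wants every term there.\<close>
    define w where "w n = z (n + m)" for n
    have ev: "\<forall>\<^sub>F n in sequentially. \<phi> k (w n) i = d" if "\<forall>\<^sub>F n in sequentially. \<phi> k (z n) i = d" for i d
      using that unfolding w_def by (rule sequentially_offset)
    have "\<exists>c. \<forall>\<^sub>F n in sequentially. \<phi> k (w n) i = c" for i
    proof -
      obtain d where "\<forall>\<^sub>F n in sequentially. case_nat (N (z n)) (\<phi> (N (z n)) (z n)) (Suc i) = d"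
        using c by blast
      then have "\<forall>\<^sub>F n in sequentially. \<phi> k (z n) i = d"
        using k by eventually_elim auto
      then show ?thesis using ev by blast
    qed
    moreover have "w n \<in> S k" for n by (simp add: w_def m)
    ultimately obtain l where l: "l \<in> S k" "w \<longlonglongrightarrow> l" "\<And>i. \<forall>\<^sub>F n in sequentially. \<phi> k (w n) i = \<phi> k l i"
      using codedD[OF S[of k], of w] by metis
    have "z \<longlonglongrightarrow> l" using l(2) unfolding w_def by (rule LIMSEQ_offset)
    moreover have "\<forall>\<^sub>F n in sequentially. case_nat (N (z n)) (\<phi> (N (z n)) (z n)) i = case_nat (N l) (\<phi> (N l) l) i" for i
    proof (cases i)
      case 0 then show ?thesis using k N[OF l(1)] by simp
    next
      case (Suc j)
      have "\<forall>\<^sub>F n in sequentially. \<phi> k (z n) j = \<phi> k l j"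
        using l(3)[of j] unfolding w_def
        by (subst (asm) eventually_sequentially_seg)
      then show ?thesis using k by eventually_elim (use Suc N[OF l(1)] in auto)
    qed
    ultimately show "\<exists>l\<in>(\<Union>k. S k). z \<longlonglongrightarrow> l \<and> (\<forall>i. \<forall>\<^sub>F n in sequentially.
        case_nat (N (z n)) (\<phi> (N (z n)) (z n)) i = case_nat (N l) (\<phi> (N l) l) i)"
      using l(1) by blast
  qed
qed

text \<open>The coordinate \<open>(k, i)\<close> of the code of \<open>x\<close> says whether \<open>x\<close> lies in the basic set \<open>U k\<close>, and
  if so, names the first basic set of diameter at most \<open>1 / Suc i\<close> around \<open>x\<close> whose closure lies in
  \<open>U k\<close>. The closure makes the limit stay in \<open>U k\<close>.\<close>

lemma polish_coded_UNIV:
  obtains \<phi> :: "'a::{complete_space,second_countable_topology} \<Rightarrow> nat \<Rightarrow> nat" and B :: "'a set set"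
  where "coded \<phi> UNIV" "countable B" "topological_basis B" "\<And>b. b \<in> B \<Longrightarrow> \<exists>i. b = {x. \<phi> x i \<noteq> 0}"
proof -
  obtain B :: "'a set set" where B: "countable B" "topological_basis B"
    using ex_countable_basis by blast
  \<comment> \<open>\<open>UNIV\<close> is added so that one index \<open>k0\<close> contains every
    point; its coordinates name ever smaller sets and force Cauchyness.\<close>
  define U where "U = from_nat_into (insert UNIV B)"
  have rU: "range U = insert UNIV B" using B(1) by (simp add: U_def range_from_nat_into)
  have oU: "open (U k)" for k
    using rU topological_basis_open[OF B(2)] by (metis insertE open_UNIV rangeI)
  define adm where "adm k i j \<longleftrightarrow> closure (U j) \<subseteq> U k \<and> (\<forall>u\<in>U j. \<forall>v\<in>U j. dist u v < 1 / Suc i)" for k i j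
  have ex: "\<exists>j. x \<in> U j \<and> adm k i j" if x: "x \<in> U k" for x k i
  proof -
    obtain e where e: "e > 0" "ball x e \<subseteq> U k" using openE[OF oU x] by blast
    \<comment> \<open>The bound \<open>e/2\<close> keeps the closed ball of radius \<open>r\<close>
      inside \<open>ball x e\<close>; the other bound makes the diameter condition hold.\<close>
    define r where "r = min (e/2) (1 / (2 * Suc i))"
    have r: "r > 0" "r < e" "2 * r \<le> 1 / Suc i" using e by (simp_all add: r_def min_less_iff_disj, simp add: min_def field_simps)
    obtain b where b: "b \<in> B" "x \<in> b" "b \<subseteq> ball x r"
      using topological_basisE[OF B(2) open_ball, of x x r] r(1) by auto
    obtain j where j: "b = U j" using b(1) rU by blast
    have "closure b \<subseteq> cball x r"
      using b(3) ball_subset_cball by (intro closure_minimal closed_cball) blast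
    also have "\<dots> \<subseteq> U k" using e(2) r(2) by (auto simp: subset_iff)
    finally have "closure b \<subseteq> U k" .
    moreover have "dist u v < 1 / Suc i" if "u \<in> b" "v \<in> b" for u v
    proof -
      have "dist x u < r" "dist x v < r" using that b(3) by auto
      then show ?thesis using r(3) dist_triangle3[of u v x] by linarith
    qed
    ultimately show ?thesis using b j unfolding adm_def by blast
  qed
  define L where "L x k i = (LEAST j. x \<in> U j \<and> adm k i j)" for x k i
  define \<phi> where "\<phi> x m = (if x \<in> U (fst (prod_decode m)) then Suc (L x (fst (prod_decode m)) (snd (prod_decode m))) else 0)" for x m
  have \<phi>: "\<phi> x (prod_encode (k,i)) = (if x \<in> U k then Suc (L x k i) else 0)" for x k i
    by (simp add: \<phi>_def)
  have L: "x \<in> U (L x k i) \<and> adm k i (L x k i)" if "x \<in> U k" for x k i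
    unfolding L_def using ex[OF that] by (rule LeastI_ex)
  have Lless: "x \<notin> U j" if "j < L x k i" "adm k i j" for x k i j
    using not_less_Least that unfolding L_def by blast
  have "coded \<phi> UNIV"
    unfolding coded_def
  proof (intro allI impI, elim conjE)
    fix z assume c: "\<forall>i. \<exists>c. \<forall>\<^sub>F n in sequentially. \<phi> (z n) i = c"
    have step: "(\<forall>\<^sub>F n in sequentially. z n \<notin> U k) \<or>
        (\<exists>j. adm k i j \<and> (\<forall>\<^sub>F n in sequentially. z n \<in> U k \<and> z n \<in> U j \<and> L (z n) k i = j))" for k i
    proof -
      obtain d where d: "\<forall>\<^sub>F n in sequentially. \<phi> (z n) (prod_encode (k,i)) = d" using c by blast
      show ?thesis
      proof (cases d)
        case 0
        then have "\<forall>\<^sub>F n in sequentially. z n \<notin> U k"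
          using d by (auto simp: \<phi> elim!: eventually_mono split: if_splits)
        then show ?thesis by blast
      next
        case (Suc j)
        have *: "\<forall>\<^sub>F n in sequentially. z n \<in> U k \<and> L (z n) k i = j"
          using d Suc by (auto simp: \<phi> elim!: eventually_mono split: if_splits)
        then obtain n where "z n \<in> U k \<and> L (z n) k i = j"
          using eventually_happens'[OF sequentially_bot] by blast
        then have "adm k i j" using L by blast
        moreover have "\<forall>\<^sub>F n in sequentially. z n \<in> U k \<and> z n \<in> U j \<and> L (z n) k i = j"
          using * by eventually_elim (use L in blast)
        ultimately show ?thesis by blast
      qed
    qed
    obtain k0 where k0: "U k0 = UNIV" using rU by (metis insertI1 rangeE)
    have "Cauchy z"
    proof (rule metric_CauchyI)
      fix e :: real assume "e > 0"
      then obtain i where i: "1 / Suc i < e" using nat_approx_posE by blast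
      obtain j where j: "adm k0 i j" "\<forall>\<^sub>F n in sequentially. z n \<in> U j"
        using step[of k0 i] k0 by (auto simp: eventually_conj_iff)
      obtain M where "\<And>n. n \<ge> M \<Longrightarrow> z n \<in> U j" using j(2) by (auto simp: eventually_sequentially)
      then have "\<forall>m\<ge>M. \<forall>n\<ge>M. dist (z m) (z n) < e"
        using j(1) i unfolding adm_def by (meson less_trans)
      then show "\<exists>M. \<forall>m\<ge>M. \<forall>n\<ge>M. dist (z m) (z n) < e" by blast
    qed
    then obtain l where l: "z \<longlonglongrightarrow> l" using Cauchy_convergent convergent_def by blast
    \<comment> \<open>If the sequence did not eventually leave \<open>U k\<close>, its code would
      name a set \<open>U j\<close> that eventually contains it and has its closure in
      \<open>U k\<close>, and the limit would lie in that closure.\<close>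
    have out: "\<forall>\<^sub>F n in sequentially. z n \<notin> U k" if "l \<notin> U k" for k
    proof (rule ccontr)
      assume "\<not> ?thesis"
      then obtain j where j: "adm k 0 j" "\<forall>\<^sub>F n in sequentially. z n \<in> U j"
        using step[of k 0] by (auto simp: eventually_conj_iff)
      have "\<forall>\<^sub>F n in sequentially. z n \<in> closure (U j)"
        using j(2) by eventually_elim (use closure_subset in blast)
      then have "l \<in> closure (U j)"
        using Lim_in_closed_set[OF closed_closure _ sequentially_bot l] by blast
      then show False using j(1) that unfolding adm_def by blast
    qed
    have inn: "\<forall>\<^sub>F n in sequentially. z n \<in> U k" if "l \<in> U k" for k
      using topological_tendstoD[OF l oU that] .
    have "\<forall>\<^sub>F n in sequentially. \<phi> (z n) m = \<phi> l m" for m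
    proof -
      obtain k i where m: "m = prod_encode (k,i)" by (metis prod_decode_inverse surj_pair)
      show ?thesis
      proof (cases "l \<in> U k")
        case False
        show ?thesis unfolding m \<phi> using out[OF False] by eventually_elim (use False in auto)
      next
        case True
        have "\<not> (\<forall>\<^sub>F n in sequentially. z n \<notin> U k)"
          using inn[OF True] eventually_happens'[OF sequentially_bot]
          by (metis (mono_tags, lifting) eventually_conj)
        then obtain j where j: "adm k i j" "\<forall>\<^sub>F n in sequentially. z n \<in> U k \<and> z n \<in> U j \<and> L (z n) k i = j"
          using step[of k i] by blast
        \<comment> \<open>Membership in each basic set is eventually the same for \<open>z n\<close>
          as for \<open>l\<close>, by \<open>out\<close> and \<open>inn\<close>, so the least
          admissible index is the same too.\<close>
        have "L l k i = j" unfolding L_def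
        proof (rule Least_equality)
          have "l \<in> U j"
          proof (rule ccontr)
            assume "l \<notin> U j"
            from eventually_conj[OF out[OF this] j(2)] show False
              using eventually_happens'[OF sequentially_bot] by blast
          qed
          then show "l \<in> U j \<and> adm k i j" using j by blast
        next
          fix j' assume j': "l \<in> U j' \<and> adm k i j'"
          show "j \<le> j'"
          proof (rule ccontr)
            assume "\<not> j \<le> j'"
            moreover from j' have "\<forall>\<^sub>F n in sequentially. z n \<in> U j'" using inn by blast
            from eventually_conj[OF this j(2)] obtain n where "z n \<in> U j'" "L (z n) k i = j"
              using eventually_happens'[OF sequentially_bot] by blast
            ultimately show False using Lless[of j' "z n" k i] j' by auto
          qed
        qed
        then show ?thesis unfolding m \<phi> using j(2) True by (auto elim: eventually_mono)
      qed
    qed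
    then show "\<exists>l\<in>UNIV. z \<longlonglongrightarrow> l \<and> (\<forall>i. \<forall>\<^sub>F n in sequentially. \<phi> (z n) i = \<phi> l i)"
      using l by blast
  qed
  moreover have "\<exists>i. b = {x. \<phi> x i \<noteq> 0}" if b: "b \<in> B" for b
  proof -
    obtain k where "b = U k" using b rU by blast
    then have "b = {x. \<phi> x (prod_encode (k,0)) \<noteq> 0}" by (auto simp: \<phi>)
    then show ?thesis by blast
  qed
  ultimately show thesis using that B by blast
qed

text \<open>The induction carries \<open>S\<close> together with its complement: codes pass to
  countable intersections and disjoint unions, and making a union disjoint uses the complements of
  the earlier sets.\<close>

lemma borel_coded:
  fixes S :: "'a::{complete_space,second_countable_topology} set"
  assumes "S \<in> sets borel"
  obtains \<phi> where "coded \<phi> S"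
proof -
  obtain \<phi> :: "'a \<Rightarrow> nat \<Rightarrow> nat" and B where \<phi>: "coded \<phi> UNIV" and
    B: "countable B" "topological_basis B" "\<And>b. b \<in> B \<Longrightarrow> \<exists>i. b = {x. \<phi> x i \<noteq> 0}"
    using polish_coded_UNIV by blast
  have inter: "\<exists>\<phi>. coded \<phi> (\<Inter>k. T k)" if "\<And>k. \<exists>\<phi>. coded \<phi> (T k)" for T :: "nat \<Rightarrow> 'a set"
  proof -
    from that obtain \<psi> where "\<And>k. coded (\<psi> k) (T k)" by metis
    then show ?thesis using coded_Int by blast
  qed
  have "S \<in> sigma_sets UNIV B" using assms by (simp add: borel_eq_countable_basis[OF B(1,2)])
  then have "(\<exists>\<phi>. coded \<phi> S) \<and> (\<exists>\<phi>. coded \<phi> (- S))"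
  proof induction
    case (Basic b)
    then obtain i where i: "b = {x. \<phi> x i \<noteq> 0}" using B(3) by blast
    then have "- b = {x. \<phi> x i = 0}" by auto
    then show ?case
      using coded_Collect[OF \<phi>, of "\<lambda>c. c \<noteq> 0" i] coded_Collect[OF \<phi>, of "\<lambda>c. c = 0" i] i by auto
  next
    case Empty
    then show ?case using \<phi> by (auto simp: coded_def)
  next
    case (Compl a)
    then show ?case by (simp add: Compl_eq_Diff_UNIV[symmetric])
  next
    case (Union a)
    \<comment> \<open>The set \<open>a n\<close> without its predecessors, written as a countable
      intersection to which \<open>inter\<close> applies.\<close>
    define T where "T n = (\<Inter>k. if k < n then - a k else a n)" for n
    have "\<exists>\<phi>. coded \<phi> (T n)" for n
      unfolding T_def using Union.IH by (intro inter) (auto split: if_splits)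
    then obtain \<psi> where "\<And>n. coded (\<psi> n) (T n)" by metis
    moreover have "T n = disjointed a n" for n
    proof (intro set_eqI iffI)
      fix x assume "x \<in> T n"
      then have *: "x \<in> (if k < n then - a k else a n)" for k unfolding T_def by blast
      have "x \<notin> a k" if "k < n" for k using *[of k] that by simp
      then show "x \<in> disjointed a n" using *[of n] by (simp add: disjointed_def)
    qed (auto simp: T_def disjointed_def)
    ultimately have "\<exists>\<phi>. coded \<phi> (\<Union>n. disjointed a n)"
      using coded_disjoint_Un[of \<psi> "disjointed a"] disjoint_family_disjointed[of a] by auto
    moreover have "\<exists>\<phi>. coded \<phi> (\<Inter>n. - a n)" using Union.IH by (intro inter) auto
    ultimately show ?case by (simp add: UN_disjointed_eq)
  qed
  then show thesis using that by blast
qed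

section \<open>Separation of disjoint images by Borel sets\<close>

definition borel_sep :: "'a::topological_space set \<Rightarrow> 'a set \<Rightarrow> bool" where
  "borel_sep A B \<longleftrightarrow> (\<exists>C\<in>sets borel. A \<subseteq> C \<and> C \<inter> B = {})"

text \<open>Used contrapositively: if two unions cannot be separated, then some pair of pieces
  cannot, which permits the descent from a cell to a deeper one.\<close>

lemma borel_sep_UN:
  assumes "\<And>(m::nat) (n::nat). borel_sep (A m) (B n)"
  shows "borel_sep (\<Union>m. A m) (\<Union>n. B n)"
proof -
  obtain C where C: "\<And>m n. C m n \<in> sets borel" "\<And>m n. A m \<subseteq> C m n" "\<And>m n. C m n \<inter> B n = {}"
    using assms unfolding borel_sep_def by metis
  have "(\<Union>m. \<Inter>n. C m n) \<in> sets borel" using C(1)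
    by (intro sets.countable_UN'' sets.countable_INT'') auto
  moreover have "(\<Union>m. A m) \<subseteq> (\<Union>m. \<Inter>n. C m n)" using C(2) by blast
  moreover have "(\<Union>m. \<Inter>n. C m n) \<inter> (\<Union>n. B n) = {}" using C(3) by blast
  ultimately show ?thesis unfolding borel_sep_def by blast
qed

text \<open>Any choice of points from the sets \<open>A n\<close> has codes converging to
  \<open>a\<close>, so all choices converge to the one point \<open>l\<close> with code
  \<open>a\<close>. Points \<open>w n\<close> whose images avoid a neighbourhood of
  \<open>f l\<close> would contradict continuity.\<close>

lemma coded_shrinking:
  fixes S :: "'a::t2_space set" and f :: "'a \<Rightarrow> 'b::topological_space"
  assumes S: "coded \<phi> S" and f: "continuous_on S f"
    and A: "\<And>n. A n \<subseteq> S" "\<And>n. A n \<noteq> {}" and dec: "decseq A"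
    and a: "\<And>n z. z \<in> A (Suc n) \<Longrightarrow> \<phi> z n = a n"
  obtains l where "l \<in> S" "\<And>U. open U \<Longrightarrow> f l \<in> U \<Longrightarrow> \<exists>n. f ` A n \<subseteq> U"
proof -
  have lim: "\<exists>l\<in>S. z \<longlonglongrightarrow> l \<and> (\<forall>i. \<phi> l i = a i)" if z: "\<And>n. z n \<in> A n" for z
  proof -
    have ev: "\<forall>\<^sub>F n in sequentially. \<phi> (z n) i = a i" for i
      unfolding eventually_sequentially
    proof (intro exI allI impI)
      fix n assume "Suc i \<le> n"
      then have "z n \<in> A (Suc i)" using z[of n] decseqD[OF dec] by blast
      then show "\<phi> (z n) i = a i" by (rule a)
    qed
    obtain l where l: "l \<in> S" "z \<longlonglongrightarrow> l" "\<And>i. \<forall>\<^sub>F n in sequentially. \<phi> (z n) i = \<phi> l i"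
      using codedD[OF S, of z] ev z A(1) by (metis subsetD)
    have "\<phi> l i = a i" for i
      using eventually_conj[OF l(3)[of i] ev[of i]] eventually_happens'[OF sequentially_bot] by fastforce
    with l show ?thesis by blast
  qed
  have "\<forall>n. \<exists>z. z \<in> A n" using A(2) by blast
  then obtain z where z: "\<And>n. z n \<in> A n" by metis
  from lim[OF this] obtain l where l: "l \<in> S" "\<And>i. \<phi> l i = a i" by blast
  show thesis
  proof (rule that[OF l(1)], rule ccontr)
    fix U assume U: "open U" "f l \<in> U" and "\<nexists>n. f ` A n \<subseteq> U"
    then have "\<forall>n. \<exists>w. w \<in> A n \<and> f w \<notin> U" by blast
    then obtain w where w: "\<And>n. w n \<in> A n" "\<And>n. f (w n) \<notin> U" by metis
    from lim[OF w(1)] obtain l' where l': "l' \<in> S" "w \<longlonglongrightarrow> l'" "\<And>i. \<phi> l' i = a i" by blast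
    have "l' = l" using coded_inj[OF S l'(1) l(1)] l(2) l'(3) by simp
    moreover have "w n \<in> S" for n using w(1) A(1) by blast
    ultimately have "(\<lambda>n. f (w n)) \<longlonglongrightarrow> f l"
      using continuous_on_tendsto_compose[OF f l'(2,1)] by simp
    from topological_tendstoD[OF this U] w(2) show False by simp
  qed
qed

text \<open>Lusin's separation theorem: if the images were inseparable, then so would be the images of
  two cells at every depth; these shrink to two distinct points, which open sets separate.\<close>

lemma lusin_separation:
  fixes f :: "'a::t2_space \<Rightarrow> 'c::t2_space" and g :: "'b::t2_space \<Rightarrow> 'c"
  assumes S: "coded \<phi> S" and T: "coded \<psi> T"
    and f: "continuous_on S f" and g: "continuous_on T g" and disj: "f ` S \<inter> g ` T = {}"
  shows "borel_sep (f ` S) (g ` T)"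
proof (rule ccontr)
  assume nsep: "\<not> borel_sep (f ` S) (g ` T)"
  have "\<exists>P. \<forall>n. \<not> borel_sep (f ` fst (P n)) (g ` snd (P n)) \<and> fst (P n) \<subseteq> S \<and> snd (P n) \<subseteq> T \<and>
     (\<exists>a b. P (Suc n) = ({z \<in> fst (P n). \<phi> z n = a}, {z \<in> snd (P n). \<psi> z n = b}))"
  proof -
    have "\<exists>P. \<forall>n. (\<not> borel_sep (f ` fst (P n)) (g ` snd (P n)) \<and> fst (P n) \<subseteq> S \<and> snd (P n) \<subseteq> T) \<and>
     (\<exists>a b. P (Suc n) = ({z \<in> fst (P n). \<phi> z n = a}, {z \<in> snd (P n). \<psi> z n = b}))"
    proof (rule dependent_nat_choice)
      show "\<exists>P. \<not> borel_sep (f ` fst P) (g ` snd P) \<and> fst P \<subseteq> S \<and> snd P \<subseteq> T"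
        using nsep by (intro exI[of _ "(S,T)"]) auto
    next
      fix P :: "'a set \<times> 'b set" and n
      assume P: "\<not> borel_sep (f ` fst P) (g ` snd P) \<and> fst P \<subseteq> S \<and> snd P \<subseteq> T"
      have eq: "f ` fst P = (\<Union>a. f ` {z \<in> fst P. \<phi> z n = a})" "g ` snd P = (\<Union>b. g ` {z \<in> snd P. \<psi> z n = b})"
        by auto
      have "\<exists>a b. \<not> borel_sep (f ` {z \<in> fst P. \<phi> z n = a}) (g ` {z \<in> snd P. \<psi> z n = b})"
      proof (rule ccontr)
        assume "\<not> ?thesis"
        then have "borel_sep (f ` fst P) (g ` snd P)" unfolding eq by (intro borel_sep_UN) blast
        then show False using P by blast
      qed
      then obtain a b where ab: "\<not> borel_sep (f ` {z \<in> fst P. \<phi> z n = a}) (g ` {z \<in> snd P. \<psi> z n = b})" by blast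
      show "\<exists>Q. (\<not> borel_sep (f ` fst Q) (g ` snd Q) \<and> fst Q \<subseteq> S \<and> snd Q \<subseteq> T) \<and>
         (\<exists>a b. Q = ({z \<in> fst P. \<phi> z n = a}, {z \<in> snd P. \<psi> z n = b}))"
        by (rule exI[of _ "({z \<in> fst P. \<phi> z n = a}, {z \<in> snd P. \<psi> z n = b})"]) (use P ab in auto)
    qed
    then show ?thesis by simp
  qed
  then obtain P where P: "\<And>n. \<not> borel_sep (f ` fst (P n)) (g ` snd (P n))" "\<And>n. fst (P n) \<subseteq> S" "\<And>n. snd (P n) \<subseteq> T"
    and step: "\<forall>n. \<exists>a b. P (Suc n) = ({z \<in> fst (P n). \<phi> z n = a}, {z \<in> snd (P n). \<psi> z n = b})" by blast
  from step have "\<exists>a. \<forall>n. \<exists>b. P (Suc n) = ({z \<in> fst (P n). \<phi> z n = a n}, {z \<in> snd (P n). \<psi> z n = b})" by (rule choice)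
  then obtain a where "\<forall>n. \<exists>b. P (Suc n) = ({z \<in> fst (P n). \<phi> z n = a n}, {z \<in> snd (P n). \<psi> z n = b})" ..
  then have "\<exists>b. \<forall>n. P (Suc n) = ({z \<in> fst (P n). \<phi> z n = a n}, {z \<in> snd (P n). \<psi> z n = b n})" by (rule choice)
  then obtain b where ab: "\<And>n. P (Suc n) = ({z \<in> fst (P n). \<phi> z n = a n}, {z \<in> snd (P n). \<psi> z n = b n})" by blast
  \<comment> \<open>An empty image is separated from anything by the empty set or by the whole
    space.\<close>
  have ne: "fst (P n) \<noteq> {}" "snd (P n) \<noteq> {}" for n
    using P(1)[of n] unfolding borel_sep_def by (auto intro: bexI[of _ "{}"] bexI[of _ UNIV])
  have dec: "decseq (\<lambda>n. fst (P n))" "decseq (\<lambda>n. snd (P n))"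
    by (auto simp: decseq_Suc_iff ab)
  obtain l where l: "l \<in> S" "\<And>U. open U \<Longrightarrow> f l \<in> U \<Longrightarrow> \<exists>n. f ` fst (P n) \<subseteq> U"
    using coded_shrinking[OF S f P(2) ne(1) dec(1), of a] ab by auto
  obtain m where m: "m \<in> T" "\<And>U. open U \<Longrightarrow> g m \<in> U \<Longrightarrow> \<exists>n. g ` snd (P n) \<subseteq> U"
    using coded_shrinking[OF T g P(3) ne(2) dec(2), of b] ab by auto
  have "f l \<noteq> g m" using l(1) m(1) disj by blast
  then obtain U V where UV: "open U" "open V" "f l \<in> U" "g m \<in> V" "U \<inter> V = {}" using hausdorff by metis
  obtain i j where ij: "f ` fst (P i) \<subseteq> U" "g ` snd (P j) \<subseteq> V" using l(2) m(2) UV by meson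
  have "fst (P (max i j)) \<subseteq> fst (P i)" "snd (P (max i j)) \<subseteq> snd (P j)"
    using decseqD[OF dec(1), of i "max i j"] decseqD[OF dec(2), of j "max i j"] by simp_all
  then have "f ` fst (P (max i j)) \<subseteq> U" "g ` snd (P (max i j)) \<subseteq> V"
    using ij by blast+
  then have "borel_sep (f ` fst (P (max i j))) (g ` snd (P (max i j)))"
    unfolding borel_sep_def using UV by (intro bexI[of _ U]) auto
  then show False using P(1) by blast
qed

text \<open>Separating the images of incompatible cells by Borel sets turns the closures of the images into
  a scheme of Borel sets \<open>B s\<close> in which every point of the intersection determines one branch.\<close>

theorem lusin_souslin:
  fixes f :: "'a::{complete_space,second_countable_topology} \<Rightarrow> 'b::metric_space"
  assumes "S \<in> sets borel" and f: "continuous_on S f" and inj: "inj_on f S"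
  shows "f ` S \<in> sets borel"
proof -
  obtain \<phi> where \<phi>: "coded \<phi> S" using borel_coded[OF assms(1)] by blast
  define cell where "cell s = {z \<in> S. \<forall>i<length s. \<phi> z i = s ! i}" for s :: "nat list"
  define inc where "inc s t \<longleftrightarrow> (\<exists>i<length s. i < length t \<and> s ! i \<noteq> t ! i)" for s t :: "nat list"
  have inc_sym: "inc s t \<longleftrightarrow> inc t s" for s t by (auto simp: inc_def)
  have "borel_sep (f ` cell s) (f ` cell t)" if "inc s t" for s t
  proof (rule lusin_separation)
    show "coded \<phi> (cell s)" "coded \<phi> (cell t)" unfolding cell_def by (rule coded_cell[OF \<phi>])+
    show "continuous_on (cell s) f" "continuous_on (cell t) f"
      using f by (auto simp: cell_def intro: continuous_on_subset)
    have "cell s \<inter> cell t = {}" using that by (auto simp: cell_def inc_def)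
    then show "f ` cell s \<inter> f ` cell t = {}"
      using inj_on_image_Int[OF inj, of "cell s" "cell t"] by (auto simp: cell_def)
  qed
  then obtain C where C: "\<And>s t. inc s t \<Longrightarrow> C s t \<in> sets borel" "\<And>s t. inc s t \<Longrightarrow> f ` cell s \<subseteq> C s t"
    "\<And>s t. inc s t \<Longrightarrow> C s t \<inter> f ` cell t = {}" unfolding borel_sep_def by metis
  \<comment> \<open>Subtracting \<open>C t s\<close> makes \<open>B s\<close> and \<open>B t\<close>
    disjoint for incompatible \<open>s\<close> and \<open>t\<close>, and removes nothing from the
    image of \<open>cell s\<close>, which \<open>C t s\<close> misses.\<close>
  define B where "B s = closure (f ` cell s) \<inter> (\<Inter>t. if inc s t then C s t - C t s else UNIV)" for s
  have B: "B s \<in> sets borel" for s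
    unfolding B_def using C(1) inc_sym by (intro sets.Int sets.countable_INT'') auto
  have comp: "\<not> inc s t" if x: "x \<in> B s" "x \<in> B t" for s t x
  proof
    assume *: "inc s t"
    have "x \<in> (if inc s t then C s t - C t s else UNIV)" "x \<in> (if inc t s then C t s - C s t else UNIV)"
      using x unfolding B_def by blast+
    then show False using * inc_sym by simp
  qed
  have "f ` S = (\<Inter>n. \<Union>s\<in>{s. length s = n}. B s)"
  proof (intro subset_antisym subsetI)
    fix x assume "x \<in> f ` S"
    then obtain z where z: "z \<in> S" "x = f z" by blast
    have "x \<in> B (map (\<phi> z) [0..<n])" for n
    proof -
      have "z \<in> cell (map (\<phi> z) [0..<n])" using z by (simp add: cell_def)
      then have mem: "x \<in> f ` cell (map (\<phi> z) [0..<n])" using z(2) by blast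
      show ?thesis
        unfolding B_def
      proof (intro IntI INT_I)
        show "x \<in> closure (f ` cell (map (\<phi> z) [0..<n]))" by (rule subsetD[OF closure_subset mem])
        show "x \<in> (if inc (map (\<phi> z) [0..<n]) t
            then C (map (\<phi> z) [0..<n]) t - C t (map (\<phi> z) [0..<n]) else UNIV)" for t
        proof (cases "inc (map (\<phi> z) [0..<n]) t")
          case True
          then have "inc t (map (\<phi> z) [0..<n])" using inc_sym by blast
          then show ?thesis using C(2)[OF True] C(3)[of t] mem True by auto
        qed simp
      qed
    qed
    then show "x \<in> (\<Inter>n. \<Union>s\<in>{s. length s = n}. B s)" by (metis (mono_tags, lifting) INT_I UN_I length_map length_upt diff_zero mem_Collect_eq)
  next
    fix x assume "x \<in> (\<Inter>n. \<Union>s\<in>{s. length s = n}. B s)"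
    then have "\<forall>n. \<exists>s. length s = n \<and> x \<in> B s" by blast
    then obtain s where s: "\<And>n. length (s n) = n" "\<And>n. x \<in> B (s n)" by metis
    \<comment> \<open>By \<open>comp\<close> the lists \<open>s n\<close> are prefixes of a single
      branch. The closure in \<open>B\<close> supplies points of these cells with images approaching
      \<open>x\<close>; their codes stabilize along the branch, so they converge to a preimage of
      \<open>x\<close>.\<close>
    have "\<exists>z. z \<in> cell (s n) \<and> dist (f z) x < 1 / Suc n" for n
    proof -
      have "x \<in> closure (f ` cell (s n))" using s(2)[of n] by (simp add: B_def)
      then obtain y where "y \<in> f ` cell (s n)" "dist y x < 1 / Suc n"
        unfolding closure_approachable by (metis of_nat_0_less_iff zero_less_Suc zero_less_divide_1_iff)
      then show ?thesis by blast
    qed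
    then obtain z where z: "\<And>n. z n \<in> cell (s n)" "\<And>n. dist (f (z n)) x < 1 / Suc n" by metis
    have "\<forall>\<^sub>F n in sequentially. \<phi> (z n) i = s (Suc i) ! i" for i
      unfolding eventually_sequentially
    proof (intro exI allI impI)
      fix n assume n: "Suc i \<le> n"
      then have "\<phi> (z n) i = s n ! i" using z(1)[of n] s(1) by (simp add: cell_def)
      also have "\<dots> = s (Suc i) ! i" using comp[OF s(2)[of n] s(2)[of "Suc i"]] n s(1) by (simp add: inc_def)
      finally show "\<phi> (z n) i = s (Suc i) ! i" .
    qed
    moreover have zS: "z n \<in> S" for n using z(1)[of n] by (simp add: cell_def)
    ultimately obtain l where l: "l \<in> S" "z \<longlonglongrightarrow> l" using codedD[OF \<phi>, of z] by metis
    have "(\<lambda>n. f (z n)) \<longlonglongrightarrow> f l" using continuous_on_tendsto_compose[OF f l(2,1)] zS by simp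
    moreover have "(\<lambda>n. f (z n)) \<longlonglongrightarrow> x"
      unfolding tendsto_dist_iff[of _ x]
      by (rule tendsto_sandwich[OF _ _ tendsto_const LIMSEQ_Suc[OF lim_1_over_n]])
         (use z(2) in \<open>auto intro!: always_eventually less_imp_le\<close>)
    ultimately show "x \<in> f ` S" using l(1) LIMSEQ_unique by blast
  qed
  also have "\<dots> \<in> sets borel"
    using B by (intro sets.countable_INT'' sets.countable_UN'') auto
  finally show ?thesis .
qed

section \<open>Cardinality of sections\<close>

text \<open>The sections of maximal cardinality are enumerated by the increasing \<open>n\<close>-tuples of their
  elements, of which there is exactly one each, so that the Lusin--Souslin theorem applies.\<close>

lemma borel_card_section_max:
  fixes E :: "('a::{complete_space,second_countable_topology} \<times> real) set"
  assumes E: "E \<in> sets borel" and n: "\<And>x. finite {y. (x, y) \<in> E} \<and> card {y. (x, y) \<in> E} \<le> n"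
  shows "{x. card {y. (x, y) \<in> E} = n} \<in> sets borel"
proof -
  \<comment> \<open>The coordinates from \<open>n\<close> on are fixed to 0, since otherwise
    \<open>fst\<close> would not be injective on \<open>W\<close>.\<close>
  define W :: "('a \<times> (nat \<Rightarrow> real)) set" where
    "W = {p. (\<forall>i<n. (fst p, snd p i) \<in> E) \<and> (\<forall>j<n. \<forall>i<j. snd p i < snd p j) \<and> (\<forall>i\<ge>n. snd p i = 0)}"
  have coord: "continuous_on UNIV (\<lambda>p :: 'a \<times> (nat \<Rightarrow> real). snd p i)" for i
    by (rule continuous_on_product_then_coordinatewise[of UNIV snd, OF continuous_on_snd[OF continuous_on_id]])
  have m1: "(\<lambda>p :: 'a \<times> (nat \<Rightarrow> real). snd p i) \<in> borel_measurable borel" for i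
    by (intro borel_measurable_continuous_onI coord)
  have m2: "(\<lambda>p :: 'a \<times> (nat \<Rightarrow> real). (fst p, snd p i)) \<in> borel_measurable borel" for i
    by (intro borel_measurable_continuous_onI continuous_on_Pair coord continuous_on_fst continuous_on_id)
  have "W = (\<Inter>i\<in>{..<n}. (\<lambda>p. (fst p, snd p i)) -` E) \<inter>
     (\<Inter>j\<in>{..<n}. \<Inter>i\<in>{..<j}. {p. snd p i < snd p j}) \<inter> (\<Inter>i\<in>{n..}. {p. snd p i = 0})"
    by (auto simp: W_def)
  moreover have "(\<lambda>p :: 'a \<times> (nat \<Rightarrow> real). (fst p, snd p i)) -` E \<in> sets borel" for i
    using measurable_sets_borel[OF m2 E] .
  moreover have "{p :: 'a \<times> (nat \<Rightarrow> real). snd p i < snd p j} \<in> sets borel" for i j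
    using borel_measurable_less[OF m1 m1] by simp
  moreover have "{p :: 'a \<times> (nat \<Rightarrow> real). snd p i = 0} \<in> sets borel" for i
    using borel_measurable_eq[OF m1 borel_measurable_const] by simp
  ultimately have "W \<in> sets borel"
    by (simp only:) (intro sets.Int sets.countable_INT''; simp)
  moreover have enum: "{y. (fst p, y) \<in> E} = set (map (snd p) [0..<n]) \<and> sorted (map (snd p) [0..<n])
      \<and> distinct (map (snd p) [0..<n])" if p: "p \<in> W" for p
  proof -
    have "sorted_wrt (<) (map (snd p) [0..<n])"
      using p by (simp add: sorted_wrt_iff_nth_less W_def)
    then have sd: "sorted (map (snd p) [0..<n])" "distinct (map (snd p) [0..<n])"
      using strict_sorted_iff by blast+
    have "set (map (snd p) [0..<n]) \<subseteq> {y. (fst p, y) \<in> E}" using p by (auto simp: W_def)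
    moreover have "card (set (map (snd p) [0..<n])) = n" using distinct_card[OF sd(2)] by simp
    \<comment> \<open>Here maximality enters: \<open>n\<close> distinct points exhaust a section
      that has at most \<open>n\<close> points.\<close>
    ultimately have "set (map (snd p) [0..<n]) = {y. (fst p, y) \<in> E}"
      using n[of "fst p"] by (metis card_seteq)
    with sd show ?thesis by blast
  qed
  have "inj_on fst W"
  proof (rule inj_onI)
    fix p q assume pq: "p \<in> W" "q \<in> W" "fst p = fst q"
    have "map (snd p) [0..<n] = map (snd q) [0..<n]"
      using enum[OF pq(1)] enum[OF pq(2)] pq(3) by (intro sorted_distinct_set_unique) auto
    then have "snd p i = snd q i" if "i < n" for i using that by simp
    moreover have "snd p i = snd q i" if "i \<ge> n" for i using that pq by (simp add: W_def)
    ultimately have "snd p = snd q" by (metis ext not_le)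
    with pq(3) show "p = q" by (simp add: prod_eq_iff)
  qed
  moreover have "continuous_on W fst" by (intro continuous_on_fst continuous_on_id)
  ultimately have "fst ` W \<in> sets borel" by (intro lusin_souslin)
  moreover have "fst ` W = {x. card {y. (x, y) \<in> E} = n}"
  proof (intro subset_antisym subsetI)
    fix x assume "x \<in> fst ` W"
    then obtain p where p: "p \<in> W" "x = fst p" by blast
    show "x \<in> {x. card {y. (x, y) \<in> E} = n}"
      using enum[OF p(1)] distinct_card[of "map (snd p) [0..<n]"] p(2) by simp
  next
    fix x assume "x \<in> {x. card {y. (x, y) \<in> E} = n}"
    then have c: "card {y. (x, y) \<in> E} = n" by simp
    define l where "l = sorted_list_of_set {y. (x, y) \<in> E}"
    have l: "set l = {y. (x, y) \<in> E}" "length l = n" "sorted_wrt (<) l"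
      using n[of x] c by (simp_all add: l_def)
    then have "(x, \<lambda>i. if i < n then l ! i else 0) \<in> W"
      using nth_mem[of _ l] by (auto simp: W_def sorted_wrt_iff_nth_less)
    then show "x \<in> fst ` W" by force
  qed
  ultimately show ?thesis by simp
qed

text \<open>Smaller sections are reached by peeling: the points over which the section is largest
  form a Borel set \<open>P\<close>, and deleting the part of \<open>E\<close> over \<open>P\<close>
  lowers the bound by one.\<close>

theorem borel_card_section:
  fixes E :: "('a::{complete_space,second_countable_topology} \<times> real) set"
  assumes "E \<in> sets borel" and "\<And>x. finite {y. (x, y) \<in> E} \<and> card {y. (x, y) \<in> E} \<le> n"
  shows "{x. card {y. (x, y) \<in> E} = k} \<in> sets borel"
  using assms
proof (induction n arbitrary: E k)
  case 0
  then have "card {y. (x, y) \<in> E} = 0" for x by simp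
  then show ?case by simp
next
  case (Suc n)
  define P where "P = {x. card {y. (x, y) \<in> E} = Suc n}"
  define F where "F = E - fst -` P"
  have P: "P \<in> sets borel" unfolding P_def by (rule borel_card_section_max) (use Suc.prems in auto)
  have "fst -` P \<in> sets (borel :: ('a \<times> real) measure)"
    by (rule measurable_sets_borel[OF _ P])
       (intro borel_measurable_continuous_onI continuous_on_fst continuous_on_id)
  then have "F \<in> sets borel" using Suc.prems(1) by (auto simp: F_def)
  have sec: "{y. (x, y) \<in> F} = (if x \<in> P then {} else {y. (x, y) \<in> E})" for x
    by (auto simp: F_def)
  have "finite {y. (x, y) \<in> F} \<and> card {y. (x, y) \<in> F} \<le> n" for x
    using Suc.prems(2)[of x] by (auto simp: sec P_def)
  from Suc.IH[OF \<open>F \<in> sets borel\<close> this] have F: "{x. card {y. (x, y) \<in> F} = k} \<in> sets borel" .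
  have "{x. card {y. (x, y) \<in> E} = k} =
     (if k = Suc n then P else {x. card {y. (x, y) \<in> F} = k} - P)"
    by (auto simp: sec) (auto simp: P_def)
  then show ?case using P F by (simp add: sets.Diff)
qed

section \<open>Cheeger's inequality for measures with equal marginals\<close>

text \<open>The median is the infimum of the points where the distribution function reaches half of
  the mass: left limits bound the mass below it, right continuity the mass above it. Zero total mass
  is split off because that set of points would then be unbounded below.\<close>

lemma (in finite_measure) median_exists:
  fixes f :: "'a \<Rightarrow> real"
  assumes f[measurable]: "f \<in> borel_measurable M"
  obtains m where "measure M {x \<in> space M. f x < m} \<le> measure M (space M) / 2"
    "measure M {x \<in> space M. m < f x} \<le> measure M (space M) / 2"
proof (cases "measure M (space M) = 0")
  case True
  then have "measure M A = 0" for A using bounded_measure[of A] measure_nonneg[of M A] by linarith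
  then show thesis using that[of 0] by simp
next
  case False
  define V where "V = measure M (space M)"
  have V: "V > 0" using False zero_less_measure_iff unfolding V_def by blast
  interpret F: finite_measure "distr M borel f" by (rule finite_measure_distr) simp
  interpret F: finite_borel_measure "distr M borel f" by unfold_locales simp
  let ?F = "cdf (distr M borel f)"
  have mF: "measure (distr M borel f) S = measure M {x \<in> space M. f x \<in> S}" if "S \<in> sets borel" for S
    using that by (simp add: measure_distr vimage_def Int_def conj_commute)
  have VF: "measure (distr M borel f) (space (distr M borel f)) = V"
    by (simp add: mF V_def)
  define S where "S = {x. V / 2 \<le> ?F x}"
  define m where "m = Inf S"
  have "\<forall>\<^sub>F x in at_top. V / 2 < ?F x"
    using order_tendstoD(1)[OF F.cdf_lim_at_top, of "V / 2"] V unfolding VF by simp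
  then have ne: "S \<noteq> {}" unfolding S_def eventually_at_top_linorder by (auto intro: less_imp_le)
  have "\<forall>\<^sub>F x in at_bot. ?F x < V / 2"
    using order_tendstoD(2)[OF F.cdf_lim_at_bot, of "V / 2"] V by simp
  then obtain c where c: "\<And>x. x \<le> c \<Longrightarrow> ?F x < V / 2" unfolding eventually_at_bot_linorder by blast
  have bdd: "bdd_below S"
  proof (rule bdd_belowI[of _ c], rule ccontr)
    fix x assume "x \<in> S" "\<not> c \<le> x"
    then show False using c[of x] unfolding S_def by simp
  qed
  have below: "?F x < V / 2" if "x < m" for x
  proof (rule ccontr)
    assume "\<not> ?F x < V / 2"
    then have "x \<in> S" by (simp add: S_def)
    then show False using cInf_lower[OF _ bdd] that unfolding m_def by fastforce
  qed
  have above: "V / 2 \<le> ?F x" if x: "m < x" for x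
  proof -
    obtain s where "s \<in> S" "s < x" using cInf_lessD[OF ne] x unfolding m_def by blast
    then show ?thesis using F.cdf_nondecreasing[of s x] unfolding S_def by simp
  qed
  have "(?F \<longlongrightarrow> ?F m) (at_right m)"
    using F.cdf_is_right_cont by (simp add: continuous_within)
  then have "V / 2 \<le> ?F m"
  proof (rule tendsto_lowerbound)
    show "\<forall>\<^sub>F x in at_right m. V / 2 \<le> ?F x"
      using eventually_at_right_less[of m] by eventually_elim (rule above)
  qed simp
  moreover have "measure (distr M borel f) {..<m} \<le> V / 2"
  proof (rule tendsto_upperbound[OF F.cdf_at_left])
    show "\<forall>\<^sub>F x in at_left m. ?F x \<le> V / 2"
    proof (rule eventually_at_leftI[of "m - 1"])
      show "?F x \<le> V / 2" if "x \<in> {m - 1<..<m}" for x using below[of x] that by auto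
    qed simp
  qed simp
  moreover have "measure (distr M borel f) {m<..} = V - ?F m"
    using F.finite_measure_compl[of "{..m}"] VF
    by (simp add: cdf_def2 Compl_eq_Diff_UNIV[symmetric])
  ultimately show thesis using that[of m] by (simp add: mF V_def)
qed

text \<open>Layer-cake formula: the distance is the length of the interval between the two values,
  and Fubini exchanges points and levels. Half-open intervals match the superlevel sets
  \<open>t < G x\<close> and their complements.\<close>

lemma (in sigma_finite_measure) nn_integral_abs_diff_eq_level_sets:
  fixes u v :: "'a \<Rightarrow> real"
  assumes [measurable]: "u \<in> borel_measurable M" "v \<in> borel_measurable M"
  shows "(\<integral>\<^sup>+x. ennreal \<bar>v x - u x\<bar> \<partial>M) =
    (\<integral>\<^sup>+t. emeasure M {x \<in> space M. u x \<le> t \<and> t < v x \<or> v x \<le> t \<and> t < u x} \<partial>lborel)"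
proof -
  interpret L: pair_sigma_finite M lborel ..
  let ?I = "\<lambda>x t. indicator ({u x..<v x} \<union> {v x..<u x}) t :: ennreal"
  have "ennreal \<bar>v x - u x\<bar> = (\<integral>\<^sup>+t. ?I x t \<partial>lborel)" for x
    by (cases "u x \<le> v x") auto
  then have "(\<integral>\<^sup>+x. ennreal \<bar>v x - u x\<bar> \<partial>M) = (\<integral>\<^sup>+x. \<integral>\<^sup>+t. ?I x t \<partial>lborel \<partial>M)" by simp
  also have "\<dots> = (\<integral>\<^sup>+t. \<integral>\<^sup>+x. ?I x t \<partial>M \<partial>lborel)"
  proof (rule L.Fubini'[symmetric])
    have "(\<lambda>(x, t). ?I x t) = indicator {p. u (fst p) \<le> snd p \<and> snd p < v (fst p) \<or> v (fst p) \<le> snd p \<and> snd p < u (fst p)}"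
      by (auto simp: fun_eq_iff split: split_indicator)
    then show "(\<lambda>(x, t). ?I x t) \<in> borel_measurable (M \<Otimes>\<^sub>M lborel)"
      by (simp only:) measurable
  qed
  also have "\<dots> = (\<integral>\<^sup>+t. \<integral>\<^sup>+x. indicator {x \<in> space M. u x \<le> t \<and> t < v x \<or> v x \<le> t \<and> t < u x} x \<partial>M \<partial>lborel)"
    by (intro nn_integral_cong) (auto split: split_indicator)
  finally show ?thesis by simp
qed

text \<open>The signed square satisfies a bound by \<open>\<bar>b - a\<bar> * s\<close>: it factors
  for equal signs, and for opposite signs \<open>\<bar>b - a\<bar>\<close> is \<open>s\<close>
  itself. AM-GM then splits the product.\<close>

lemma abs_signed_square_diff_le:
  fixes a b h :: real
  assumes "h > 0"
  shows "\<bar>b * \<bar>b\<bar> - a * \<bar>a\<bar>\<bar> \<le> (b - a)\<^sup>2 / h + h / 2 * (a\<^sup>2 + b\<^sup>2)"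
proof -
  define s where "s = \<bar>a\<bar> + \<bar>b\<bar>"
  have "\<bar>b * \<bar>b\<bar> - a * \<bar>a\<bar>\<bar> \<le> \<bar>b - a\<bar> * s"
  proof (cases "a * b \<ge> 0")
    case True
    then have "b * \<bar>b\<bar> - a * \<bar>a\<bar> = (b - a) * s \<or> b * \<bar>b\<bar> - a * \<bar>a\<bar> = - ((b - a) * s)"
      unfolding s_def by (auto simp: zero_le_mult_iff abs_if algebra_simps)
    moreover have "s \<ge> 0" by (simp add: s_def)
    ultimately show ?thesis by (auto simp: abs_mult)
  next
    case False
    then have "\<bar>b - a\<bar> = s"
      unfolding s_def by (auto simp: not_le mult_less_0_iff)
    moreover from False have "b * \<bar>b\<bar> - a * \<bar>a\<bar> = a\<^sup>2 + b\<^sup>2 \<or> b * \<bar>b\<bar> - a * \<bar>a\<bar> = - (a\<^sup>2 + b\<^sup>2)"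
      by (auto simp: not_le mult_less_0_iff power2_eq_square)
    then have "\<bar>b * \<bar>b\<bar> - a * \<bar>a\<bar>\<bar> = a\<^sup>2 + b\<^sup>2"
      by (metis abs_minus_cancel abs_of_nonneg sum_power2_ge_zero)
    moreover have "a\<^sup>2 + b\<^sup>2 \<le> s * s" by (simp add: s_def power2_eq_square algebra_simps)
    ultimately show ?thesis by simp
  qed
  also have "\<dots> \<le> (b - a)\<^sup>2 / h + h / 4 * s\<^sup>2"
  proof -
    \<comment> \<open>The square is balanced so that integrating the final bound gives
      \<open>X / h + h * N\<close>.\<close>
    have "0 \<le> (2 * \<bar>b - a\<bar> - h * s)\<^sup>2 / (4 * h)" using assms by simp
    also have "\<dots> = \<bar>b - a\<bar>\<^sup>2 / h - \<bar>b - a\<bar> * s + h / 4 * s\<^sup>2"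
      using assms by (simp add: field_simps power2_eq_square)
    finally show ?thesis by simp
  qed
  also have "\<dots> \<le> (b - a)\<^sup>2 / h + h / 4 * (2 * (a\<^sup>2 + b\<^sup>2))"
  proof -
    have "0 \<le> (\<bar>a\<bar> - \<bar>b\<bar>)\<^sup>2" by simp
    then have "s\<^sup>2 \<le> 2 * (a\<^sup>2 + b\<^sup>2)" by (simp add: s_def power2_sum power2_diff)
    then show ?thesis using assms by (intro add_left_mono mult_left_mono) auto
  qed
  also have "h / 4 * (2 * (a\<^sup>2 + b\<^sup>2)) = h / 2 * (a\<^sup>2 + b\<^sup>2)" by simp
  finally show ?thesis .
qed

text \<open>Here \<open>\<nu>\<close> stands for the volume and \<open>\<eta>\<close> for the edge
  measure. Equal marginals suffice for \<open>flow\<close>: the measures of the two crossings of a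
  cut are both \<open>\<nu>\<close> of \<open>A\<close> minus \<open>\<eta>\<close> of
  \<open>A \<times> A\<close>.\<close>

theorem cheeger_inequality:
  fixes \<nu> :: "'a measure" and \<eta> :: "('a \<times> 'a) measure" and f :: "'a \<Rightarrow> real"
  assumes "finite_measure \<eta>" and sets: "sets \<eta> = sets (\<nu> \<Otimes>\<^sub>M \<nu>)"
    and marg: "distr \<eta> \<nu> fst = \<nu>" "distr \<eta> \<nu> snd = \<nu>"
    and "h \<ge> 0" and iso: "\<And>A. A \<in> sets \<nu> \<Longrightarrow>
      h * min (measure \<nu> A) (measure \<nu> (space \<nu> - A)) \<le> measure \<eta> (A \<times> (space \<nu> - A))"
    and f[measurable]: "f \<in> borel_measurable \<nu>" and f2: "integrable \<nu> (\<lambda>x. (f x)\<^sup>2)"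
    and mean: "(\<integral>x. f x \<partial>\<nu>) = 0"
  shows "integrable \<eta> (\<lambda>p. (f (snd p) - f (fst p))\<^sup>2)"
    and "h\<^sup>2 * (\<integral>x. (f x)\<^sup>2 \<partial>\<nu>) \<le> (\<integral>p. (f (snd p) - f (fst p))\<^sup>2 \<partial>\<eta>)"
proof -
  interpret E: finite_measure \<eta> by fact
  have [measurable]: "fst \<in> measurable \<eta> \<nu>" "snd \<in> measurable \<eta> \<nu>"
    by (simp_all add: measurable_cong_sets[OF sets refl])
  interpret N: finite_measure \<nu>
    using E.finite_measure_distr[of fst \<nu>] marg(1) by simp
  have spE: "space \<eta> = space \<nu> \<times> space \<nu>"
    using sets_eq_imp_space_eq[OF sets] by (simp add: space_pair_measure)
  have prod_sets[measurable]: "A \<times> B \<in> sets \<eta>" if "A \<in> sets \<nu>" "B \<in> sets \<nu>" for A B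
    using that by (simp add: sets)
  have flow: "measure \<eta> ((space \<nu> - A) \<times> A) = measure \<eta> (A \<times> (space \<nu> - A))" if A: "A \<in> sets \<nu>" for A
  proof -
    have "fst -` A \<inter> space \<eta> = A \<times> space \<nu>" "snd -` A \<inter> space \<eta> = space \<nu> \<times> A"
      using sets.sets_into_space[OF A] by (auto simp: spE)
    then have "measure \<nu> A = measure \<eta> (A \<times> space \<nu>)" "measure \<nu> A = measure \<eta> (space \<nu> \<times> A)"
      using measure_distr[of fst \<eta> \<nu> A] measure_distr[of snd \<eta> \<nu> A] A by (simp_all add: marg)
    moreover have "A \<times> space \<nu> = A \<times> A \<union> A \<times> (space \<nu> - A)" "space \<nu> \<times> A = A \<times> A \<union> (space \<nu> - A) \<times> A"
      using sets.sets_into_space[OF A] by auto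
    ultimately have "measure \<nu> A = measure \<eta> (A \<times> A) + measure \<eta> (A \<times> (space \<nu> - A))"
      "measure \<nu> A = measure \<eta> (A \<times> A) + measure \<eta> ((space \<nu> - A) \<times> A)"
      using A by (simp_all add: E.finite_measure_Union[symmetric] disjoint_iff sets.Diff)
    then show ?thesis by simp
  qed
  obtain m where m: "measure \<nu> {x \<in> space \<nu>. f x < m} \<le> measure \<nu> (space \<nu>) / 2"
    "measure \<nu> {x \<in> space \<nu>. m < f x} \<le> measure \<nu> (space \<nu>) / 2"
    using N.median_exists[OF f] by blast
  define g where "g x = f x - m" for x
  define G where "G x = g x * \<bar>g x\<bar>" for x
  have [measurable]: "g \<in> borel_measurable \<nu>" "G \<in> borel_measurable \<nu>"
    unfolding g_def G_def by measurable
  have f1: "integrable \<nu> f" using N.square_integrable_imp_integrable[OF f f2] .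
  have g2_eq: "(g x)\<^sup>2 = (f x)\<^sup>2 - 2 * m * f x + m\<^sup>2" for x
    by (simp add: g_def power2_diff)
  have g2: "integrable \<nu> (\<lambda>x. (g x)\<^sup>2)" unfolding g2_eq using f1 f2 by simp
  define N where "N = (\<integral>x. (g x)\<^sup>2 \<partial>\<nu>)"
  \<comment> \<open>The cross term vanishes because \<open>f\<close> has mean zero.\<close>
  have "N = (\<integral>x. (f x)\<^sup>2 \<partial>\<nu>) + m\<^sup>2 * measure \<nu> (space \<nu>)"
    unfolding N_def g2_eq using f1 f2 mean by simp
  then have fN: "(\<integral>x. (f x)\<^sup>2 \<partial>\<nu>) \<le> N" by simp
  have int_fst: "integrable \<eta> (\<lambda>p. (g (fst p))\<^sup>2)" "(\<integral>p. (g (fst p))\<^sup>2 \<partial>\<eta>) = N"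
    using g2 integrable_distr_eq[of fst \<eta> \<nu> "\<lambda>x. (g x)\<^sup>2"] integral_distr[of fst \<eta> \<nu> "\<lambda>x. (g x)\<^sup>2"]
    unfolding marg N_def by simp_all
  have int_snd: "integrable \<eta> (\<lambda>p. (g (snd p))\<^sup>2)" "(\<integral>p. (g (snd p))\<^sup>2 \<partial>\<eta>) = N"
    using g2 integrable_distr_eq[of snd \<eta> \<nu> "\<lambda>x. (g x)\<^sup>2"] integral_distr[of snd \<eta> \<nu> "\<lambda>x. (g x)\<^sup>2"]
    unfolding marg N_def by simp_all
  have df: "f (snd p) - f (fst p) = g (snd p) - g (fst p)" for p by (simp add: g_def)
  show int_d: "integrable \<eta> (\<lambda>p. (f (snd p) - f (fst p))\<^sup>2)"
  proof (rule Bochner_Integration.integrable_bound)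
    show "integrable \<eta> (\<lambda>p. 2 * (g (fst p))\<^sup>2 + 2 * (g (snd p))\<^sup>2)" using int_fst int_snd by simp
    have "(b - a)\<^sup>2 \<le> 2 * a\<^sup>2 + 2 * b\<^sup>2" for a b :: real
      using zero_le_power2[of "a + b"] by (simp add: power2_eq_square algebra_simps)
    then show "AE p in \<eta>. norm ((f (snd p) - f (fst p))\<^sup>2) \<le> norm (2 * (g (fst p))\<^sup>2 + 2 * (g (snd p))\<^sup>2)"
      by (simp add: df)
  qed measurable
  define X where "X = (\<integral>p. (f (snd p) - f (fst p))\<^sup>2 \<partial>\<eta>)"
  have "h\<^sup>2 * N \<le> X"
  proof (cases "h = 0")
    \<comment> \<open>Treated apart because the AM-GM bound divides by \<open>h\<close>.\<close>
    case True then show ?thesis by (simp add: X_def)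
  next
    case False
    then have h: "h > 0" using \<open>h \<ge> 0\<close> by simp
    \<comment> \<open>On the left is the level set belonging to the distance of \<open>G\<close>
      from 0, on the right the one belonging to its change along a pair; the latter is the cut of
      \<open>A\<close> in both directions.\<close>
    have lev: "ennreal (2 * h) * emeasure \<nu> {x \<in> space \<nu>. 0 \<le> t \<and> t < G x \<or> G x \<le> t \<and> t < 0}
      \<le> emeasure \<eta> {p \<in> space \<eta>. G (fst p) \<le> t \<and> t < G (snd p) \<or> G (snd p) \<le> t \<and> t < G (fst p)}" for t
    proof -
      define A where "A = {x \<in> space \<nu>. t < G x}"
      have A[measurable]: "A \<in> sets \<nu>" unfolding A_def by measurable
      have Ac: "space \<nu> - A = {x \<in> space \<nu>. G x \<le> t}" by (auto simp: A_def)
      have "{p \<in> space \<eta>. G (fst p) \<le> t \<and> t < G (snd p) \<or> G (snd p) \<le> t \<and> t < G (fst p)} =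
        (space \<nu> - A) \<times> A \<union> A \<times> (space \<nu> - A)" by (auto simp: spE A_def)
      then have cut: "measure \<eta> {p \<in> space \<eta>. G (fst p) \<le> t \<and> t < G (snd p) \<or> G (snd p) \<le> t \<and> t < G (fst p)} =
        2 * measure \<eta> (A \<times> (space \<nu> - A))"
        using flow[OF A] by (simp add: E.finite_measure_Union disjoint_iff sets.Diff)
      have "measure \<nu> {x \<in> space \<nu>. 0 \<le> t \<and> t < G x \<or> G x \<le> t \<and> t < 0}
        \<le> min (measure \<nu> A) (measure \<nu> (space \<nu> - A))"
      proof (cases "t \<ge> 0")
        case True
        then have *: "{x \<in> space \<nu>. 0 \<le> t \<and> t < G x \<or> G x \<le> t \<and> t < 0} = A" by (auto simp: A_def)
        \<comment> \<open>At a nonnegative level \<open>A\<close> lies strictly above the median, so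
          it has at most half of the volume and attains the minimum. At negative levels the
          complement of \<open>A\<close> does.\<close>
        have "m < f x" if "t < G x" for x
        proof -
          have "0 < G x" using that True by simp
          then show ?thesis by (auto simp: G_def g_def zero_less_mult_iff)
        qed
        then have "A \<subseteq> {x \<in> space \<nu>. m < f x}" unfolding A_def by blast
        then have "measure \<nu> A \<le> measure \<nu> (space \<nu>) / 2"
          using m(2) N.finite_measure_mono[of A "{x \<in> space \<nu>. m < f x}"] by force
        then show ?thesis unfolding * using N.finite_measure_compl[OF A] by simp
      next
        case False
        then have *: "{x \<in> space \<nu>. 0 \<le> t \<and> t < G x \<or> G x \<le> t \<and> t < 0} = space \<nu> - A" by (auto simp: A_def)
        have "f x < m" if "G x \<le> t" for x
        proof -
          have "G x < 0" using that False by simp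
          then show ?thesis by (auto simp: G_def g_def mult_less_0_iff)
        qed
        then have "space \<nu> - A \<subseteq> {x \<in> space \<nu>. f x < m}" unfolding Ac by blast
        then have "measure \<nu> (space \<nu> - A) \<le> measure \<nu> (space \<nu>) / 2"
          using m(1) N.finite_measure_mono[of "space \<nu> - A" "{x \<in> space \<nu>. f x < m}"] by force
        then show ?thesis unfolding * using N.finite_measure_compl[OF A] by simp
      qed
      from mult_left_mono[OF this \<open>h \<ge> 0\<close>]
      have "h * measure \<nu> {x \<in> space \<nu>. 0 \<le> t \<and> t < G x \<or> G x \<le> t \<and> t < 0} \<le> measure \<eta> (A \<times> (space \<nu> - A))"
        using iso[OF A] by (rule order_trans)
      then have "2 * h * measure \<nu> {x \<in> space \<nu>. 0 \<le> t \<and> t < G x \<or> G x \<le> t \<and> t < 0} \<le>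
        measure \<eta> {p \<in> space \<eta>. G (fst p) \<le> t \<and> t < G (snd p) \<or> G (snd p) \<le> t \<and> t < G (fst p)}"
        unfolding cut by simp
      then show ?thesis
        using h by (simp add: N.emeasure_eq_measure E.emeasure_eq_measure ennreal_mult[symmetric])
    qed
    have "ennreal (2 * h * N) = ennreal (2 * h) * (\<integral>\<^sup>+x. ennreal \<bar>G x - 0\<bar> \<partial>\<nu>)"
    proof -
      have "(\<integral>\<^sup>+x. ennreal \<bar>G x - 0\<bar> \<partial>\<nu>) = ennreal N"
        unfolding N_def using g2 by (subst nn_integral_eq_integral[symmetric]) (auto simp: G_def abs_mult power2_eq_square)
      then show ?thesis using h by (simp add: ennreal_mult N_def)
    qed
    also have "\<dots> \<le> (\<integral>\<^sup>+p. ennreal \<bar>G (snd p) - G (fst p)\<bar> \<partial>\<eta>)"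
    proof -
      have "ennreal (2 * h) * (\<integral>\<^sup>+x. ennreal \<bar>G x - 0\<bar> \<partial>\<nu>) =
        (\<integral>\<^sup>+t. ennreal (2 * h) * emeasure \<nu> {x \<in> space \<nu>. 0 \<le> t \<and> t < G x \<or> G x \<le> t \<and> t < 0} \<partial>lborel)"
        by (subst N.nn_integral_abs_diff_eq_level_sets) (auto intro!: nn_integral_cmult[symmetric])
      also have "\<dots> \<le> (\<integral>\<^sup>+p. ennreal \<bar>G (snd p) - G (fst p)\<bar> \<partial>\<eta>)"
        by (subst E.nn_integral_abs_diff_eq_level_sets) (auto intro!: nn_integral_mono lev)
      finally show "ennreal (2 * h) * (\<integral>\<^sup>+x. ennreal \<bar>G x - 0\<bar> \<partial>\<nu>) \<le>
         (\<integral>\<^sup>+p. ennreal \<bar>G (snd p) - G (fst p)\<bar> \<partial>\<eta>)" .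
    qed
    also have "\<dots> \<le> (\<integral>\<^sup>+p. ennreal ((f (snd p) - f (fst p))\<^sup>2 / h + h / 2 * ((g (fst p))\<^sup>2 + (g (snd p))\<^sup>2)) \<partial>\<eta>)"
      unfolding df G_def using abs_signed_square_diff_le[OF h] by (intro nn_integral_mono ennreal_leI)
    also have "\<dots> = ennreal (X / h + h * N)"
      using int_d int_fst int_snd h
      by (subst nn_integral_eq_integral) (auto simp: X_def)
    finally have "2 * h * N \<le> X / h + h * N"
      using h by (subst (asm) ennreal_le_iff) (auto simp: X_def N_def)
    then show ?thesis using h by (simp add: field_simps power2_eq_square)
  qed
  then show "h\<^sup>2 * (\<integral>x. (f x)\<^sup>2 \<partial>\<nu>) \<le> (\<integral>p. (f (snd p) - f (fst p))\<^sup>2 \<partial>\<eta>)"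
    using mult_left_mono[OF fN, of "h\<^sup>2"] by (simp add: X_def)
qed

section \<open>Graphings\<close>

lemma space_BI: "space BI = I01"
  by (simp add: BI_def space_restrict_space)

lemma sets_BI: "A \<in> sets BI \<longleftrightarrow> A \<in> sets borel \<and> A \<subseteq> I01"
  unfolding BI_def by (subst sets_restrict_space_iff) (auto simp: I01_def)

lemma I01_in_sets_BI: "I01 \<in> sets BI"
  using sets.top[of BI] by (simp add: space_BI)

lemma sets_BI_pair_borel: "sets (BI \<Otimes>\<^sub>M BI) \<subseteq> sets borel"
proof -
  have *: "A \<times> B \<in> sets borel" if "A \<in> sets BI" "B \<in> sets BI" for A B
    using that by (simp add: sets_BI borel_prod[symmetric])
  show ?thesis
    unfolding sets_pair_measure
    by (rule sets.sigma_sets_subset') (auto intro: * I01_in_sets_BI simp: space_BI)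
qed

lemma deg_measurable:
  assumes "bounded_degree_borel_graph E"
  shows "deg E I01 \<in> measurable BI (count_space UNIV)"
proof -
  from assms obtain D where E: "E \<in> sets (BI \<Otimes>\<^sub>M BI)"
    and D: "\<And>x. x \<in> I01 \<Longrightarrow> finite {y. (x, y) \<in> E} \<and> card {y. (x, y) \<in> E} \<le> D"
    unfolding bounded_degree_borel_graph_def by blast
  have sub: "E \<subseteq> I01 \<times> I01" using sets.sets_into_space[OF E] by (simp add: space_pair_measure space_BI)
  \<comment> \<open>The degree bound is given on \<open>I01\<close> only; elsewhere the sections are
    empty.\<close>
  have "finite {y. (x, y) \<in> E} \<and> card {y. (x, y) \<in> E} \<le> D" for x
  proof (cases "x \<in> I01")
    case False
    then have "{y. (x, y) \<in> E} = {}" using sub by blast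
    then show ?thesis by simp
  qed (rule D)
  then have "{x. card {y. (x, y) \<in> E} = k} \<in> sets borel" for k
    using E sets_BI_pair_borel by (intro borel_card_section) auto
  moreover have "{y \<in> I01. (x, y) \<in> E} = {y. (x, y) \<in> E}" for x using sub by blast
  ultimately have "deg E I01 -` {k} \<inter> space BI \<in> sets BI" for k
    by (auto simp: deg_def vimage_def space_BI sets_BI Int_def[symmetric] I01_def)
  then show ?thesis by (intro measurable_count_space_eq2_countable[THEN iffD2]) auto
qed

theorem mainTheorem4:
  fixes \<mu> :: "real measure" and E :: "(real \<times> real) set" and \<eta> :: "(real \<times> real) measure"
  assumes "graphing \<mu> E \<eta>" and "connected_graphing \<mu> E \<eta>"
  shows "lambda_G \<mu> E \<eta> \<ge> (cheeger \<mu> E \<eta>)\<^sup>2 / 8"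
proof -
  have E: "bounded_degree_borel_graph E" and prob: "prob_space \<mu>" and sets_\<mu>: "sets \<mu> = sets BI"
    and sym: "\<And>A B. A \<in> sets BI \<Longrightarrow> B \<in> sets BI \<Longrightarrow>
        (\<integral>\<^sup>+ x\<in>A. of_nat (deg E B x) \<partial>\<mu>) = (\<integral>\<^sup>+ x\<in>B. of_nat (deg E A x) \<partial>\<mu>)"
    and sets_\<eta>: "sets \<eta> = sets (BI \<Otimes>\<^sub>M BI)"
    and \<eta>: "\<And>A B. A \<in> sets BI \<Longrightarrow> B \<in> sets BI \<Longrightarrow>
        emeasure \<eta> (A \<times> B) = (\<integral>\<^sup>+ x\<in>A. of_nat (deg E B x) \<partial>\<mu>)"
    using assms(1) unfolding graphing_def by blast+
  interpret P: prob_space \<mu> by (rule prob)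
  have space_\<mu>: "space \<mu> = I01" using sets_eq_imp_space_eq[OF sets_\<mu>] by (simp add: space_BI)
  have [measurable]: "deg E I01 \<in> measurable \<mu> (count_space UNIV)"
    using deg_measurable[OF E] by (simp add: measurable_cong_sets[OF sets_\<mu> refl])
  define \<nu> where "\<nu> = density \<mu> (\<lambda>x. of_nat (deg E I01 x))"
  have sets_\<nu>: "sets \<nu> = sets BI" and space_\<nu>: "space \<nu> = I01"
    by (simp_all add: \<nu>_def sets_\<mu> space_\<mu>)
  have vol: "emeasure \<nu> A = (\<integral>\<^sup>+ x\<in>A. of_nat (deg E I01 x) \<partial>\<mu>)" if "A \<in> sets BI" for A
    using that unfolding \<nu>_def by (intro emeasure_density) (auto simp: sets_\<mu>)
  have vol_G: "vol_G \<mu> E A = measure \<nu> A" if "A \<in> sets BI" for A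
    using vol[OF that] by (simp add: vol_G_def measure_def)
  have sets_\<eta>\<nu>: "sets \<eta> = sets (\<nu> \<Otimes>\<^sub>M \<nu>)"
    unfolding sets_\<eta> by (intro sets_pair_measure_cong) (simp_all add: sets_\<nu>)
  have space_\<eta>: "space \<eta> = I01 \<times> I01"
    using sets_eq_imp_space_eq[OF sets_\<eta>] by (simp add: space_pair_measure space_BI)
  have [measurable]: "fst \<in> measurable \<eta> \<nu>" "snd \<in> measurable \<eta> \<nu>"
    by (simp_all add: measurable_cong_sets[OF sets_\<eta>\<nu> refl])
  have "finite_measure \<eta>"
  proof
    obtain D where D: "\<And>x. x \<in> I01 \<Longrightarrow> finite {y. (x, y) \<in> E} \<and> card {y. (x, y) \<in> E} \<le> D"
      using E unfolding bounded_degree_borel_graph_def by blast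
    have "deg E I01 x \<le> D" if "x \<in> I01" for x
      using card_mono[of "{y. (x, y) \<in> E}" "{y \<in> I01. (x, y) \<in> E}"] D[OF that] unfolding deg_def by fastforce
    then have "emeasure \<eta> (space \<eta>) \<le> (\<integral>\<^sup>+ x. of_nat D \<partial>\<mu>)"
      unfolding space_\<eta> \<eta>[OF I01_in_sets_BI I01_in_sets_BI]
      by (intro nn_integral_mono) (auto split: split_indicator)
    also have "\<dots> < \<infinity>" by (simp add: P.emeasure_space_1 ennreal_of_nat_eq_real_of_nat)
    finally show "emeasure \<eta> (space \<eta>) \<noteq> \<infinity>" by simp
  qed
  \<comment> \<open>The first marginal comes from the formula for \<open>\<eta>\<close> on
    rectangles, the second also from the symmetry condition \<open>sym\<close>.\<close>
  have marg: "distr \<eta> \<nu> fst = \<nu>" "distr \<eta> \<nu> snd = \<nu>"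
  proof -
    show "distr \<eta> \<nu> fst = \<nu>"
    proof (rule measure_eqI)
      fix A assume "A \<in> sets (distr \<eta> \<nu> fst)"
      then have A: "A \<in> sets BI" by (simp add: sets_\<nu>)
      then have "fst -` A \<inter> space \<eta> = A \<times> I01" using sets_BI by (auto simp: space_\<eta>)
      then show "emeasure (distr \<eta> \<nu> fst) A = emeasure \<nu> A"
        using A by (simp add: emeasure_distr sets_\<nu> vol \<eta> I01_in_sets_BI)
    qed simp
    show "distr \<eta> \<nu> snd = \<nu>"
    proof (rule measure_eqI)
      fix A assume "A \<in> sets (distr \<eta> \<nu> snd)"
      then have A: "A \<in> sets BI" by (simp add: sets_\<nu>)
      then have "snd -` A \<inter> space \<eta> = I01 \<times> A" using sets_BI by (auto simp: space_\<eta>)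
      then show "emeasure (distr \<eta> \<nu> snd) A = emeasure \<nu> A"
        using A sym[OF I01_in_sets_BI A] by (simp add: emeasure_distr sets_\<nu> vol \<eta> I01_in_sets_BI)
    qed simp
  qed
  have null: "measure \<nu> A = 0" if A: "A \<in> sets BI" "measure \<mu> A = 0" for A
  proof -
    have "A \<in> null_sets \<mu>" using A by (auto simp: null_sets_def sets_\<mu> P.emeasure_eq_measure)
    then have "AE x in \<mu>. x \<notin> A" by (rule AE_not_in)
    then have "(\<integral>\<^sup>+ x\<in>A. of_nat (deg E I01 x) \<partial>\<mu>) = (\<integral>\<^sup>+ x. 0 \<partial>\<mu>)"
      by (intro nn_integral_cong_AE) (auto elim: eventually_mono)
    then show ?thesis using vol[OF A(1)] by (simp add: measure_def)
  qed
  \<comment> \<open>Positive volume on both sides makes \<open>A\<close> a competitor for the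
    Cheeger constant, by \<open>null\<close>. If one volume is 0 the bound is trivial, so quotients
    with denominator 0 do no harm.\<close>
  have iso: "h * min (measure \<nu> A) (measure \<nu> (I01 - A)) \<le> measure \<eta> (A \<times> (I01 - A))"
    if h: "ereal h \<le> cheeger \<mu> E \<eta>" and A: "A \<in> sets BI" for h A
  proof -
    have Ac: "I01 - A \<in> sets BI" using A I01_in_sets_BI by auto
    show ?thesis
    proof (cases "min (measure \<nu> A) (measure \<nu> (I01 - A)) > 0")
      case True
      then have "measure \<mu> A \<noteq> 0" "measure \<mu> (I01 - A) \<noteq> 0" using null A Ac by auto
      then have "0 < measure \<mu> A" "measure \<mu> A < 1"
        using P.prob_compl[of A] A measure_nonneg[of \<mu> A] P.prob_le_1[of A]
        by (auto simp: space_\<mu> sets_\<mu> less_le)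
      then have "cheeger \<mu> E \<eta> \<le> ereal (e_G \<eta> A (I01 - A) / min (vol_G \<mu> E A) (vol_G \<mu> E (I01 - A)))"
        unfolding cheeger_def using A by (intro Inf_lower) blast
      with h have "ereal h \<le> ereal (e_G \<eta> A (I01 - A) / min (vol_G \<mu> E A) (vol_G \<mu> E (I01 - A)))"
        by (rule order_trans)
      then have "h \<le> measure \<eta> (A \<times> (I01 - A)) / min (measure \<nu> A) (measure \<nu> (I01 - A))"
        using A Ac by (simp add: e_G_def vol_G)
      then show ?thesis using True by (simp add: pos_le_divide_eq)
    next
      case False
      then have "min (measure \<nu> A) (measure \<nu> (I01 - A)) = 0"
        by (simp add: min_def not_less measure_le_0_iff split: if_splits)
      then show ?thesis by simp
    qed
  qed
  \<comment> \<open>Stated for real \<open>h\<close> below the Cheeger constant, because the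
    constant itself may be infinite.\<close>
  have bound: "ereal (h\<^sup>2 / 8) \<le> lambda_G \<mu> E \<eta>" if "0 \<le> h" and h: "ereal h \<le> cheeger \<mu> E \<eta>" for h
    unfolding lambda_G_def
  proof (rule Inf_greatest, clarify)
    fix f assume f[measurable]: "f \<in> borel_measurable \<mu>" and pos: "0 < vnorm2 \<mu> E f" and fin: "vnorm2 \<mu> E f < \<infinity>"
      and mean: "(\<integral>x. f x * real (deg E I01 x) \<partial>\<mu>) = 0"
    have f\<nu>: "f \<in> borel_measurable \<nu>" by (simp add: \<nu>_def)
    have v: "vnorm2 \<mu> E f = (\<integral>\<^sup>+x. ennreal ((f x)\<^sup>2) \<partial>\<nu>)"
      unfolding vnorm2_def \<nu>_def
      by (subst nn_integral_density) (auto intro!: nn_integral_cong simp: ennreal_mult ennreal_of_nat_eq_real_of_nat mult.commute)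
    have f2: "integrable \<nu> (\<lambda>x. (f x)\<^sup>2)"
      using f\<nu> fin unfolding v by (intro integrableI_nonneg) auto
    define N where "N = (\<integral>x. (f x)\<^sup>2 \<partial>\<nu>)"
    have vN: "vnorm2 \<mu> E f = ennreal N"
      unfolding v N_def using f2 by (intro nn_integral_eq_integral) auto
    then have N: "N > 0" using pos by simp
    have "(\<integral>x. f x \<partial>\<nu>) = (\<integral>x. f x * real (deg E I01 x) \<partial>\<mu>)"
      unfolding \<nu>_def ennreal_of_nat_eq_real_of_nat
      by (subst integral_density) (auto simp: mult.commute)
    with mean have mean\<nu>: "(\<integral>x. f x \<partial>\<nu>) = 0" by simp
    have iso\<nu>: "h * min (measure \<nu> A) (measure \<nu> (space \<nu> - A)) \<le> measure \<eta> (A \<times> (space \<nu> - A))"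
      if "A \<in> sets \<nu>" for A using iso[OF h] that by (simp add: sets_\<nu> space_\<nu>)
    note ch = cheeger_inequality[OF \<open>finite_measure \<eta>\<close> sets_\<eta>\<nu> marg \<open>0 \<le> h\<close> iso\<nu> f\<nu> f2 mean\<nu>]
    define X where "X = (\<integral>p. (f (snd p) - f (fst p))\<^sup>2 \<partial>\<eta>)"
    have dX: "dnorm2 \<eta> f = ennreal (X / 2)"
      unfolding dnorm2_def X_def using nn_integral_eq_integral[OF ch(1)]
      by (simp add: ennreal_divide_numeral)
    have "h\<^sup>2 * N \<le> X" using ch(2) by (simp add: N_def X_def)
    moreover have "0 \<le> h\<^sup>2 * N" using N by simp
    \<comment> \<open>The estimate would allow 2 in place of 8; nonnegativity permits the
      weakening.\<close>
    ultimately have "h\<^sup>2 / 8 * N \<le> X / 2" by (simp add: mult.commute)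
    then have "h\<^sup>2 / 8 \<le> X / 2 / N" using N by (simp only: pos_le_divide_eq)
    moreover have "X \<ge> 0" by (simp add: X_def)
    ultimately show "ereal (h\<^sup>2 / 8) \<le> enn2ereal (dnorm2 \<eta> f) / enn2ereal (vnorm2 \<mu> E f)"
      unfolding dX vN using N by (simp add: enn2ereal_ennreal)
  qed
  have c0: "0 \<le> cheeger \<mu> E \<eta>"
    unfolding cheeger_def by (rule Inf_greatest) (auto simp: e_G_def vol_G_def)
  show ?thesis
  proof (cases "cheeger \<mu> E \<eta>")
    case (real r)
    then show ?thesis using bound[of r] c0 by (simp add: power2_eq_square)
  next
    case PInf
    \<comment> \<open>No set is admissible for the Cheeger constant here, so \<open>bound\<close>
      holds for every \<open>h \<ge> 0\<close>. The choice \<open>8 + \<bar>b\<bar>\<close> is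
      nonnegative and has a square of at least \<open>8 * b\<close>.\<close>
    have "lambda_G \<mu> E \<eta> = \<infinity>"
    proof (rule ereal_top)
      fix b :: real
      have "8 * b \<le> b * b + (64 + 16 * \<bar>b\<bar>)"
        using zero_le_square[of b] abs_ge_self[of b] abs_ge_zero[of b] by linarith
      then have "b \<le> (8 + \<bar>b\<bar>)\<^sup>2 / 8" by (simp add: power2_eq_square algebra_simps)
      then show "ereal b \<le> lambda_G \<mu> E \<eta>"
        using bound[of "8 + \<bar>b\<bar>"] PInf by (auto intro: order_trans[of _ "ereal ((8 + \<bar>b\<bar>)\<^sup>2 / 8)"])
    qed
    then show ?thesis by simp
  qed (use c0 in simp)
qed

end
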